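(* Let $\mathcal{T}^h=\{S\}$ be a family of polytopal partitions of $\Omega\subset\mathbb{R}^d$, $d\in\{2,3\}$, into $S$-elements, and let $\mathbb{S}_k^h$ and $\mathcal{V}_k^{h,\Delta}$ be the SBFEM and harmonic virtual spaces based on $\mathcal{T}^h$. Suppose the same trace interpolant $\mathcal{I}_k^h$ is used in the definitions of the SBFEM interpolant $\Pi_k^h$ and of the harmonic virtual interpolant $\mathcal{F}_k^{h,\Delta}$, and that the exact solution $u\in H^1(\Omega)$ of the model problem $\Delta u=0$ in $\Omega$, $u=u_D$ on $\partial\Omega$, is sufficiently regular for these interpolants to make sense. If $u^h\in\mathbb{S}_k^h$ is the associated Galerkin SBFEM approximation, i.e. $$\int_\Omega\nabla u^h\cdot\nabla v\,d\Omega=0\quad\forall v\in\mathbb{S}_k^h\cap H^1_0(\Omega),\qquad u^h|_{\partial\Omega}=\mathcal{I}_k^hu_D|_{\partial\Omega},$$ then $$|u-u^h|_{H^1(\Omega)}\le|u-\mathcal{F}_k^{h,\Delta}u|_{H^1(\Omega)}+|\mathcal{F}_k^{h,\Delta}u-\Pi_k^h\,\mathcal{F}_k^{h,\Delta}u|_{H^1(\Omega)},$$ where $|w|_{H^1(\Omega)}=\|\nabla w\|_{L^2(\Omega)}$.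
   Context: **Meshes.** $\mathcal{T}^h=\{S\}$ is a conformal partition of $\Omega$ into $S$-elements. An $S$-element is a convex polytope with flat facets and with a point $\mathbf O=\mathbf O_S\in S$ (scaling center) from which every point of its boundary is directly visible. Its scaled boundary $\Gamma^S$ is the union of its facets $L$ (segments if $d=2$; triangles or quadrilaterals if $d=3$), and it is conformally partitioned into sectors $K$ (affine triangles, pyramids or tetrahedra, all of the same type), each having $\mathbf O$ as a vertex and one facet $L\subset\Gamma^S$ opposite to $\mathbf O$. $\mathcal{E}^h$ is the set of all facets, $\Gamma^h=\bigcup_{L\in\mathcal{E}^h}L$ is the mesh skeleton, and $h$ is the characteristic size of the facets. **Trace spaces.** $V_k(L)$ is the space of polynomials of total degree at most $k$ if $L$ is a segment or triangle, and the (mapped) space of polynomials of degree at most $k$ in each coordinate if $L$ is a quadrilateral. $\Lambda_k(\Gamma^h)=\{\alpha\in C^0(\Gamma^h):\alpha|_L\in V_k(L)\ \forall L\in\mathcal{E}^h\}$, and $\Lambda_k(\Gamma^S)$ is defined likewise on $\Gamma^S$. **Duffy and SBFEM spaces.** Points of $S$ are written $\mathbf x=\mathbf O+\xi(\mathbf x_b-\mathbf O)$, $\xi\in[0,1]$, $\mathbf x_b\in\Gamma^S$. $\mathcal{D}_k(S)$ is the function space consisting of the $\phi\in H^1(S)$ obtained by radial extension, $\phi(\mathbf x)=\rho(\xi)\alpha(\mathbf x_b)$, with $\alpha\in\Lambda_k(\Gamma^S)$ and $\rho$ a radial function on $[0,1]$, the same in all sectors. $\mathcal{D}_0(S)$ is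 the class obtained from constant traces, i.e. functions $C\rho(\xi)$, and $\mathcal{D}_0^0(S)\subset\mathcal{D}_0(S)$ is the subspace with $\rho(1)=0$. $\mathbb{S}_k(S)$ is the set of $\phi\in\mathcal{D}_k(S)$ with $\int_S\nabla\phi\cdot\nabla\psi\,dS=0$ for all $\psi\in\mathcal{D}_0^0(S)$ with $\psi(\mathbf O)=0$. Finally $\mathbb{S}_k^h=\{w\in H^1(\Omega):w|_S\in\mathbb{S}_k(S)\ \forall S\in\mathcal{T}^h\}$. **Harmonic virtual space.** $\mathcal{V}_k^{h,\Delta}=\{w\in\mathcal{H}(\Omega):w|_{\Gamma^h}\in\Lambda_k(\Gamma^h)\}$, where $\mathcal{H}(\Omega)$ denotes harmonic functions; the functions of the local spaces $\mathcal{V}_k^{h,\Delta}|_S$ are harmonic in $S$. **Interpolants.** The trace interpolant $\mathcal{I}_k^h$ maps sufficiently smooth functions $w$ to $\mathcal{I}_k^hw\in\Lambda_k(\Gamma^h)$. It is defined facet by facet, depends only on the restriction of $w$ to the facets, follows any of the interpolation strategies used for $H^1$-conforming finite element spaces, and satisfies $\mathcal{I}_k^hw=w|_{\Gamma^h}$ if $w\in H^1(\Omega)$ and $w|_S\in\mathcal{D}_k(S)$ for all $S$. - SBFEM interpolant $\Pi_k^hw\in\mathbb{S}_k^h$, defined elementwise: $\Pi_k^hw|_S\in\mathcal{D}_k(S)$ satisfies $\int_S\nabla(\Pi_k^hw)\cdot\nabla v\,dS=0$ for all $v\in\mathcal{D}_0^0(S)$ and $\Pi_k^hw|_{\Gamma^S}=\mathcal{I}_k^hw|_{\Gamma^S}$.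 - Harmonic virtual interpolant $\mathcal{F}_k^{h,\Delta}w\in\mathcal{V}_k^{h,\Delta}$, defined by solving in each $S\in\mathcal{T}^h$ the local Laplace problem $\int_S\nabla(\mathcal{F}_k^{h,\Delta}w)\cdot\nabla v\,dS=0$ for all $v\in H_0^1(S)$, $\mathcal{F}_k^{h,\Delta}w|_{\Gamma^S}=\mathcal{I}_k^hw|_{\Gamma^S}$. *)

theory Defs
  imports "HOL-Analysis.Analysis"
begin

section \<open>Sobolev spaces\<close>

text \<open>
  Elements of the function spaces below are represented by functions on the whole type, of which
  only the values on the relevant set, up to null sets, matter.
\<close>

definition L2 :: "'b measure \<Rightarrow> ('b \<Rightarrow> 'c::euclidean_space) set" where
  "L2 M = {f \<in> borel_measurable M. integrable M (\<lambda>x. (norm (f x))\<^sup>2)}"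

definition L2_norm :: "'b measure \<Rightarrow> ('b \<Rightarrow> 'c::euclidean_space) \<Rightarrow> real" where
  "L2_norm M f = sqrt (\<integral>x. (norm (f x))\<^sup>2 \<partial>M)"

primrec times_cont_diff :: "nat \<Rightarrow> ('a::euclidean_space \<Rightarrow> real) \<Rightarrow> bool" where
  "times_cont_diff 0 f \<longleftrightarrow> continuous_on UNIV f"
| "times_cont_diff (Suc m) f \<longleftrightarrow>
     (\<forall>x. f differentiable (at x)) \<and>
     (\<forall>i\<in>Basis. times_cont_diff m (\<lambda>x. frechet_derivative f (at x) i))"

definition smooth :: "('a::euclidean_space \<Rightarrow> real) \<Rightarrow> bool" where
  "smooth f \<longleftrightarrow> (\<forall>m. times_cont_diff m f)"

definition test_functions :: "'a::euclidean_space set \<Rightarrow> ('a \<Rightarrow> real) set" where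
  "test_functions U =
     {\<phi>. smooth \<phi> \<and> (\<exists>K. compact K \<and> K \<subseteq> U \<and> (\<forall>x. x \<notin> K \<longrightarrow> \<phi> x = 0))}"

definition weak_gradient ::
    "'a::euclidean_space set \<Rightarrow> ('a \<Rightarrow> real) \<Rightarrow> ('a \<Rightarrow> 'a) \<Rightarrow> bool" where
  "weak_gradient U w G \<longleftrightarrow>
     (\<forall>\<phi>\<in>test_functions U. \<forall>i\<in>Basis.
        (\<integral>x. w x * frechet_derivative \<phi> (at x) i \<partial>lebesgue_on U) =
        - (\<integral>x. (G x \<bullet> i) * \<phi> x \<partial>lebesgue_on U))"

definition H1 :: "'a::euclidean_space set \<Rightarrow> ('a \<Rightarrow> real) set" where
  "H1 U = {w \<in> L2 (lebesgue_on U). \<exists>G\<in>L2 (lebesgue_on U). weak_gradient U w G}"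

definition wgrad :: "'a::euclidean_space set \<Rightarrow> ('a \<Rightarrow> real) \<Rightarrow> 'a \<Rightarrow> 'a" where
  "wgrad U w = (SOME G. G \<in> L2 (lebesgue_on U) \<and> weak_gradient U w G)"

definition H1_seminorm :: "'a::euclidean_space set \<Rightarrow> ('a \<Rightarrow> real) \<Rightarrow> real" where
  "H1_seminorm U w = L2_norm (lebesgue_on U) (wgrad U w)"

definition H1_norm :: "'a::euclidean_space set \<Rightarrow> ('a \<Rightarrow> real) \<Rightarrow> real" where
  "H1_norm U w = sqrt ((L2_norm (lebesgue_on U) w)\<^sup>2 + (H1_seminorm U w)\<^sup>2)"

definition dirichlet_form ::
    "'a::euclidean_space set \<Rightarrow> ('a \<Rightarrow> real) \<Rightarrow> ('a \<Rightarrow> real) \<Rightarrow> real" where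
  "dirichlet_form U w v = (\<integral>x. wgrad U w x \<bullet> wgrad U v x \<partial>lebesgue_on U)"


section \<open>Traces on flat facets\<close>

definition unit_normal :: "'a::euclidean_space set \<Rightarrow> 'a" where
  "unit_normal L = (SOME n. norm n = 1 \<and> (\<forall>x\<in>L. \<forall>y\<in>L. n \<bullet> (x - y) = 0))"

text \<open>
  Surface measure of a facet \<open>L\<close> of codimension one: the area of \<open>A \<subseteq> L\<close> is the volume of the
  right cylinder of height one over \<open>A\<close>, i.e. the surface measure is the image of the volume on a
  slab of width one under the orthogonal projection onto the hyperplane of \<open>L\<close>.
\<close>

definition facet_measure :: "'a::euclidean_space set \<Rightarrow> 'a measure" where
  "facet_measure L =
     (let n = unit_normal L; p = (SOME p. p \<in> L)
      in restrict_space
           (distr (lebesgue_on {y. 0 \<le> n \<bullet> (y - p) \<and> n \<bullet> (y - p) \<le> 1}) borel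
              (\<lambda>y. y - (n \<bullet> (y - p)) *\<^sub>R n)) L)"

text \<open>
  The trace of \<open>w \<in> H\<^sup>1(U)\<close> on a facet \<open>L\<close> of \<open>U\<close> is \<open>g \<in> L\<^sup>2(L)\<close>: the graph of the extension
  by continuity of the restriction map on functions smooth up to the boundary.
\<close>

definition has_trace ::
    "'a::euclidean_space set \<Rightarrow> 'a set \<Rightarrow> ('a \<Rightarrow> real) \<Rightarrow> ('a \<Rightarrow> real) \<Rightarrow> bool" where
  "has_trace U L w g \<longleftrightarrow>
     w \<in> H1 U \<and> g \<in> L2 (facet_measure L) \<and>
     (\<exists>\<phi>. (\<forall>m::nat. smooth (\<phi> m) \<and> \<phi> m \<in> H1 U \<and> \<phi> m \<in> L2 (facet_measure L)) \<and>
          (\<lambda>m. H1_norm U (\<lambda>x. \<phi> m x - w x)) \<longlonglongrightarrow> 0 \<and>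
          (\<lambda>m. L2_norm (facet_measure L) (\<lambda>x. \<phi> m x - g x)) \<longlonglongrightarrow> 0)"


section \<open>Meshes\<close>

definition seg_map :: "'a::euclidean_space \<Rightarrow> 'a \<Rightarrow> real \<Rightarrow> 'a" where
  "seg_map a b t = (1 - t) *\<^sub>R a + t *\<^sub>R b"

definition tri_map :: "'a::euclidean_space \<Rightarrow> 'a \<Rightarrow> 'a \<Rightarrow> real \<Rightarrow> real \<Rightarrow> 'a" where
  "tri_map a b c s t = (1 - s - t) *\<^sub>R a + s *\<^sub>R b + t *\<^sub>R c"

definition quad_map :: "'a::euclidean_space \<Rightarrow> 'a \<Rightarrow> 'a \<Rightarrow> 'a \<Rightarrow> real \<Rightarrow> real \<Rightarrow> 'a" where
  "quad_map a b c d s t =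
     ((1 - s) * (1 - t)) *\<^sub>R a + (s * (1 - t)) *\<^sub>R b + (s * t) *\<^sub>R c + ((1 - s) * t) *\<^sub>R d"

definition segment_on :: "'a::euclidean_space set \<Rightarrow> 'a \<Rightarrow> 'a \<Rightarrow> bool" where
  "segment_on L a b \<longleftrightarrow> a \<noteq> b \<and> L = closed_segment a b"

definition triangle_on :: "'a::euclidean_space set \<Rightarrow> 'a \<Rightarrow> 'a \<Rightarrow> 'a \<Rightarrow> bool" where
  "triangle_on L a b c \<longleftrightarrow> \<not> collinear {a, b, c} \<and> L = convex hull {a, b, c}"

text \<open>
  Vertices in cyclic order. The diagonals of a nondegenerate quadrilateral cross in their
  relative interiors exactly when it is planar and strictly convex.
\<close>

definition quad_on :: "'a::euclidean_space set \<Rightarrow> 'a \<Rightarrow> 'a \<Rightarrow> 'a \<Rightarrow> 'a \<Rightarrow> bool" where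
  "quad_on L a b c d \<longleftrightarrow>
     \<not> collinear {a, b, c} \<and> open_segment a c \<inter> open_segment b d \<noteq> {} \<and>
     L = convex hull {a, b, c, d}"

definition facets_conformal :: "'a::euclidean_space set set \<Rightarrow> bool" where
  "facets_conformal \<L> \<longleftrightarrow> (\<forall>L\<in>\<L>. \<forall>L'\<in>\<L>. (L \<inter> L') face_of L \<and> (L \<inter> L') face_of L')"

text \<open>
  An S-element \<open>S\<close> with facets \<open>\<L>\<close> and scaling center \<open>c\<close>. Several facets may lie in one
  hyperplane (as for elements with hanging nodes), hence \<open>\<L>\<close> is a datum. Visibility of the whole
  boundary forces \<open>c\<close> into the interior, so that the sectors \<open>convex hull (insert c L)\<close> are
  nondegenerate and, by conformity of the facets, partition \<open>S\<close> conformally. The last condition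
  says that they are all triangles, all tetrahedra or all pyramids.
\<close>

definition s_element :: "'a::euclidean_space set \<Rightarrow> 'a set set \<Rightarrow> 'a \<Rightarrow> bool" where
  "s_element S \<L> c \<longleftrightarrow>
     polytope S \<and> interior S \<noteq> {} \<and>
     c \<in> S \<and> (\<forall>x\<in>frontier S. closed_segment c x \<inter> frontier S = {x}) \<and>
     finite \<L> \<and> \<Union>\<L> = frontier S \<and> facets_conformal \<L> \<and>
     (DIM('a) = 2 \<and> (\<forall>L\<in>\<L>. \<exists>a b. segment_on L a b) \<or>
      DIM('a) = 3 \<and> ((\<forall>L\<in>\<L>. \<exists>a b c. triangle_on L a b c) \<or>
                      (\<forall>L\<in>\<L>. \<exists>a b c d. quad_on L a b c d)))"

record 'a sb_mesh =
  elements :: "'a set set"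
  facets :: "'a set \<Rightarrow> 'a set set"
  center :: "'a set \<Rightarrow> 'a"

definition all_facets :: "'a sb_mesh \<Rightarrow> 'a set set" where
  "all_facets M = (\<Union>S\<in>elements M. facets M S)"

definition boundary_facets :: "'a::euclidean_space sb_mesh \<Rightarrow> 'a set \<Rightarrow> 'a set set" where
  "boundary_facets M \<Omega> = {L \<in> all_facets M. L \<subseteq> frontier \<Omega>}"

definition conformal_partition :: "'a::euclidean_space sb_mesh \<Rightarrow> 'a set \<Rightarrow> bool" where
  "conformal_partition M \<Omega> \<longleftrightarrow>
     open \<Omega> \<and> finite (elements M) \<and> closure \<Omega> = \<Union>(elements M) \<and>
     frontier \<Omega> = \<Union>(boundary_facets M \<Omega>) \<and>
     (\<forall>S\<in>elements M. s_element S (facets M S) (center M S)) \<and>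
     (\<forall>S\<in>elements M. \<forall>S'\<in>elements M. S \<noteq> S' \<longrightarrow> interior S \<inter> interior S' = {}) \<and>
     facets_conformal (all_facets M)"

text \<open>The trace of \<open>w\<close> on a facet, taken from every element having that facet.\<close>

definition facet_trace ::
    "'a::euclidean_space sb_mesh \<Rightarrow> 'a set \<Rightarrow> ('a \<Rightarrow> real) \<Rightarrow> ('a \<Rightarrow> real) \<Rightarrow> bool" where
  "facet_trace M L w g \<longleftrightarrow>
     (\<forall>S\<in>elements M. L \<in> facets M S \<longrightarrow> has_trace (interior S) L w g)"

text \<open>
  \<open>H\<^sup>1\<^sub>0\<close> consists of the functions with zero trace; the mesh only serves to describe the trace on the
  boundary of \<open>\<Omega>\<close> facet by facet.
\<close>

definition H10 :: "'a::euclidean_space sb_mesh \<Rightarrow> 'a set \<Rightarrow> ('a \<Rightarrow> real) set" where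
  "H10 M \<Omega> = {v \<in> H1 \<Omega>. \<forall>L\<in>boundary_facets M \<Omega>. facet_trace M L v (\<lambda>_. 0)}"

definition H10_element :: "'a::euclidean_space sb_mesh \<Rightarrow> 'a set \<Rightarrow> ('a \<Rightarrow> real) set" where
  "H10_element M S =
     {v \<in> H1 (interior S). \<forall>L\<in>facets M S. has_trace (interior S) L v (\<lambda>_. 0)}"


section \<open>Trace spaces\<close>

definition facet_poly_space :: "nat \<Rightarrow> 'a::euclidean_space set \<Rightarrow> ('a \<Rightarrow> real) set" where
  "facet_poly_space k L = {\<alpha>.
     (\<exists>a b q. segment_on L a b \<and>
        (\<forall>t\<in>{0..1}. \<alpha> (seg_map a b t) = (\<Sum>i\<le>k. q i * t ^ i))) \<or>
     (\<exists>a b c q. triangle_on L a b c \<and>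
        (\<forall>s\<ge>0. \<forall>t\<ge>0. s + t \<le> 1 \<longrightarrow>
           \<alpha> (tri_map a b c s t) = (\<Sum>i\<le>k. \<Sum>j\<le>k - i. q i j * s ^ i * t ^ j))) \<or>
     (\<exists>a b c d q. quad_on L a b c d \<and>
        (\<forall>s\<in>{0..1}. \<forall>t\<in>{0..1}.
           \<alpha> (quad_map a b c d s t) = (\<Sum>i\<le>k. \<Sum>j\<le>k. q i j * s ^ i * t ^ j)))}"

definition trace_space :: "nat \<Rightarrow> 'a::euclidean_space set set \<Rightarrow> ('a \<Rightarrow> real) set" where
  "trace_space k \<L> =
     {\<alpha>. continuous_on (\<Union>\<L>) \<alpha> \<and> (\<forall>L\<in>\<L>. \<alpha> \<in> facet_poly_space k L)}"


section \<open>Duffy and SBFEM spaces\<close>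

definition radial_extension ::
    "'a::euclidean_space sb_mesh \<Rightarrow> 'a set \<Rightarrow> (real \<Rightarrow> real) \<Rightarrow> ('a \<Rightarrow> real) \<Rightarrow> ('a \<Rightarrow> real) \<Rightarrow> bool"
  where
  "radial_extension M S \<rho> \<alpha> \<phi> \<longleftrightarrow>
     (AE x in lebesgue_on (interior S). \<forall>\<xi> xb.
        0 < \<xi> \<and> \<xi> \<le> 1 \<and> xb \<in> \<Union>(facets M S) \<and> x = center M S + \<xi> *\<^sub>R (xb - center M S)
        \<longrightarrow> \<phi> x = \<rho> \<xi> * \<alpha> xb)"

text \<open>
  Since functions are identified up to null sets, \<open>\<rho>\<close> is taken to be the representative that is
  continuous away from the scaling center (a product in \<open>H\<^sup>1(S)\<close> has one); only then is \<open>\<rho> 1\<close>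
  meaningful.
\<close>

definition duffy_products ::
    "'a::euclidean_space sb_mesh \<Rightarrow> nat \<Rightarrow> 'a set \<Rightarrow> ('a \<Rightarrow> real) set" where
  "duffy_products M k S =
     {\<phi> \<in> H1 (interior S). \<exists>\<rho> \<alpha>. continuous_on {0<..1} \<rho> \<and> \<alpha> \<in> trace_space k (facets M S) \<and>
        radial_extension M S \<rho> \<alpha> \<phi>}"

text \<open>The linear span of the products (modulo null sets).\<close>

definition duffy_space ::
    "'a::euclidean_space sb_mesh \<Rightarrow> nat \<Rightarrow> 'a set \<Rightarrow> ('a \<Rightarrow> real) set" where
  "duffy_space M k S =
     {\<phi> \<in> H1 (interior S). \<exists>(m::nat) f. (\<forall>j<m. f j \<in> duffy_products M k S) \<and>
        (AE x in lebesgue_on (interior S). \<phi> x = (\<Sum>j<m. f j x))}"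

definition duffy_const0 :: "'a::euclidean_space sb_mesh \<Rightarrow> 'a set \<Rightarrow> ('a \<Rightarrow> real) set" where
  "duffy_const0 M S =
     {\<psi> \<in> H1 (interior S). \<exists>\<rho> C. continuous_on {0<..1} \<rho> \<and> \<rho> 1 = 0 \<and>
        radial_extension M S \<rho> (\<lambda>_. C) \<psi>}"

definition has_point_value ::
    "'a::euclidean_space set \<Rightarrow> ('a \<Rightarrow> real) \<Rightarrow> 'a \<Rightarrow> real \<Rightarrow> bool" where
  "has_point_value U \<psi> p c \<longleftrightarrow>
     (\<exists>\<psi>'. (AE x in lebesgue_on U. \<psi>' x = \<psi> x) \<and> isCont \<psi>' p \<and> \<psi>' p = c)"

definition sbfem_local ::
    "'a::euclidean_space sb_mesh \<Rightarrow> nat \<Rightarrow> 'a set \<Rightarrow> ('a \<Rightarrow> real) set" where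
  "sbfem_local M k S =
     {\<phi> \<in> duffy_space M k S.
        \<forall>\<psi>\<in>duffy_const0 M S. has_point_value (interior S) \<psi> (center M S) 0 \<longrightarrow>
          dirichlet_form (interior S) \<phi> \<psi> = 0}"

definition sbfem_space ::
    "'a::euclidean_space sb_mesh \<Rightarrow> 'a set \<Rightarrow> nat \<Rightarrow> ('a \<Rightarrow> real) set" where
  "sbfem_space M \<Omega> k = {w \<in> H1 \<Omega>. \<forall>S\<in>elements M. w \<in> sbfem_local M k S}"


section \<open>Harmonic virtual space\<close>

definition harmonic_in_element ::
    "'a::euclidean_space sb_mesh \<Rightarrow> 'a set \<Rightarrow> ('a \<Rightarrow> real) \<Rightarrow> bool" where
  "harmonic_in_element M S w \<longleftrightarrow>
     w \<in> H1 (interior S) \<and> (\<forall>v\<in>H10_element M S. dirichlet_form (interior S) w v = 0)"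

text \<open>
  Harmonicity is required in each element only: a function harmonic in all of \<open>\<Omega>\<close> would not in
  general have a piecewise polynomial trace on the mesh skeleton.
\<close>

definition harmonic_virtual_space ::
    "'a::euclidean_space sb_mesh \<Rightarrow> 'a set \<Rightarrow> nat \<Rightarrow> ('a \<Rightarrow> real) set" where
  "harmonic_virtual_space M \<Omega> k =
     {w \<in> H1 \<Omega>. (\<forall>S\<in>elements M. harmonic_in_element M S w) \<and>
        (\<exists>\<alpha>\<in>trace_space k (all_facets M). \<forall>L\<in>all_facets M. facet_trace M L w \<alpha>)}"


section \<open>Interpolants\<close>

text \<open>
  A trace interpolant \<open>I\<close> on the space \<open>W\<close> of sufficiently smooth functions. It acts facet by
  facet: \<open>I w\<close> on \<open>L\<close> is \<open>J L\<close> applied to the restriction (trace) of \<open>w\<close> to \<open>L\<close>; the facet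
  operators \<open>J L\<close> also give a meaning to the interpolant of data known on boundary facets only.
  As \<open>I w\<close> depends on \<open>w\<close> only through its traces, so does membership in \<open>W\<close>.
\<close>

definition trace_interpolant ::
    "'a::euclidean_space sb_mesh \<Rightarrow> 'a set \<Rightarrow> nat \<Rightarrow> ('a \<Rightarrow> real) set \<Rightarrow>
     (('a \<Rightarrow> real) \<Rightarrow> 'a \<Rightarrow> real) \<Rightarrow> ('a set \<Rightarrow> ('a \<Rightarrow> real) \<Rightarrow> 'a \<Rightarrow> real) \<Rightarrow> bool" where
  "trace_interpolant M \<Omega> k W I J \<longleftrightarrow>
     W \<subseteq> H1 \<Omega> \<and>
     (\<forall>w\<in>W. I w \<in> trace_space k (all_facets M)) \<and>
     (\<forall>w\<in>W. \<forall>L\<in>all_facets M. \<forall>g. facet_trace M L w g \<longrightarrow> (\<forall>x\<in>L. I w x = J L g x)) \<and>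
     (\<forall>w\<in>W. \<forall>w'\<in>H1 \<Omega>.
        (\<forall>L\<in>all_facets M. \<exists>g. facet_trace M L w g \<and> facet_trace M L w' g) \<longrightarrow> w' \<in> W) \<and>
     (\<forall>w\<in>H1 \<Omega>. (\<forall>S\<in>elements M. w \<in> duffy_space M k S) \<longrightarrow>
        w \<in> W \<and> (\<forall>L\<in>all_facets M. facet_trace M L w (I w)))"

definition sbfem_interpolant ::
    "'a::euclidean_space sb_mesh \<Rightarrow> 'a set \<Rightarrow> nat \<Rightarrow> ('a \<Rightarrow> real) set \<Rightarrow>
     (('a \<Rightarrow> real) \<Rightarrow> 'a \<Rightarrow> real) \<Rightarrow> (('a \<Rightarrow> real) \<Rightarrow> 'a \<Rightarrow> real) \<Rightarrow> bool" where
  "sbfem_interpolant M \<Omega> k W I P \<longleftrightarrow>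
     (\<forall>w\<in>W. P w \<in> sbfem_space M \<Omega> k \<and>
        (\<forall>S\<in>elements M. P w \<in> duffy_space M k S \<and>
           (\<forall>v\<in>duffy_const0 M S. dirichlet_form (interior S) (P w) v = 0) \<and>
           (\<forall>L\<in>facets M S. has_trace (interior S) L (P w) (I w))))"

definition harmonic_interpolant ::
    "'a::euclidean_space sb_mesh \<Rightarrow> 'a set \<Rightarrow> nat \<Rightarrow> ('a \<Rightarrow> real) set \<Rightarrow>
     (('a \<Rightarrow> real) \<Rightarrow> 'a \<Rightarrow> real) \<Rightarrow> (('a \<Rightarrow> real) \<Rightarrow> 'a \<Rightarrow> real) \<Rightarrow> bool" where
  "harmonic_interpolant M \<Omega> k W I F \<longleftrightarrow>
     (\<forall>w\<in>W. F w \<in> harmonic_virtual_space M \<Omega> k \<and>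
        (\<forall>S\<in>elements M.
           (\<forall>v\<in>H10_element M S. dirichlet_form (interior S) (F w) v = 0) \<and>
           (\<forall>L\<in>facets M S. has_trace (interior S) L (F w) (I w))))"


section \<open>Model problem and Galerkin approximation\<close>

text \<open>\<open>\<Delta>u = 0\<close> in the weak sense, with Dirichlet data \<open>uD\<close>.\<close>

definition model_solution ::
    "'a::euclidean_space sb_mesh \<Rightarrow> 'a set \<Rightarrow> ('a \<Rightarrow> real) \<Rightarrow> ('a \<Rightarrow> real) \<Rightarrow> bool" where
  "model_solution M \<Omega> uD u \<longleftrightarrow>
     u \<in> H1 \<Omega> \<and> (\<forall>v\<in>H10 M \<Omega>. dirichlet_form \<Omega> u v = 0) \<and>
     (\<forall>L\<in>boundary_facets M \<Omega>. facet_trace M L u uD)"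

definition galerkin_sbfem ::
    "'a::euclidean_space sb_mesh \<Rightarrow> 'a set \<Rightarrow> nat \<Rightarrow> ('a set \<Rightarrow> ('a \<Rightarrow> real) \<Rightarrow> 'a \<Rightarrow> real) \<Rightarrow>
     ('a \<Rightarrow> real) \<Rightarrow> ('a \<Rightarrow> real) \<Rightarrow> bool" where
  "galerkin_sbfem M \<Omega> k J uD uh \<longleftrightarrow>
     uh \<in> sbfem_space M \<Omega> k \<and>
     (\<forall>v\<in>sbfem_space M \<Omega> k \<inter> H10 M \<Omega>. dirichlet_form \<Omega> uh v = 0) \<and>
     (\<forall>L\<in>boundary_facets M \<Omega>. facet_trace M L uh (J L uD))"

end

theory Submission
  imports Defs
begin

text \<open>
  Galerkin orthogonality makes \<open>u\<^sup>h\<close> the best approximation of \<open>u\<close> among the SBFEM functions with the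
  same boundary trace. Since \<open>Fu\<close> and \<open>\<Pi>u\<close> both have trace \<open>Iu\<close> on the skeleton, and \<open>I\<close>
  reproduces the trace of \<open>\<Pi>u\<close>, the function \<open>\<Pi>Fu\<close> is such a competitor, and the triangle
  inequality through \<open>Fu\<close> gives the estimate. For the \<open>H\<^sup>1\<close> seminorm, defined through a choice of
  weak gradient, to be a seminorm, weak gradients must be unique almost everywhere.
\<close>

section \<open>Smooth bump functions\<close>

lemma times_cont_diff_Suc_imp:
  "times_cont_diff (Suc m) f \<Longrightarrow> times_cont_diff m f"
proof (induction m arbitrary: f)
  case 0
  then show ?case
    by (auto intro!: continuous_at_imp_continuous_on differentiable_imp_continuous_within)
next
  case (Suc m)
  then show ?case
    by (metis times_cont_diff.simps(2))
qed

lemma times_cont_diff_const [simp]: "times_cont_diff m (\<lambda>x. c)"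
  by (induction m arbitrary: c) auto

lemma times_cont_diff_add:
  "times_cont_diff m f \<Longrightarrow> times_cont_diff m g \<Longrightarrow> times_cont_diff m (\<lambda>x. f x + g x)"
proof (induction m arbitrary: f g)
  case 0
  then show ?case by (auto intro: continuous_on_add)
next
  case (Suc m)
  have "frechet_derivative (\<lambda>x. f x + g x) (at x) =
      (\<lambda>i. frechet_derivative f (at x) i + frechet_derivative g (at x) i)" for x
    using Suc.prems
    by (intro frechet_derivative_at [symmetric] has_derivative_add)
      (auto simp flip: frechet_derivative_works)
  then show ?case
    using Suc by simp
qed

lemma times_cont_diff_mult:
  "times_cont_diff m f \<Longrightarrow> times_cont_diff m g \<Longrightarrow> times_cont_diff m (\<lambda>x. f x * g x)"
proof (induction m arbitrary: f g)
  case 0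
  then show ?case by (auto intro: continuous_on_mult)
next
  case (Suc m)
  have "frechet_derivative (\<lambda>x. f x * g x) (at x) =
      (\<lambda>i. f x * frechet_derivative g (at x) i + frechet_derivative f (at x) i * g x)" for x
    using Suc.prems
    by (intro frechet_derivative_at [symmetric] has_derivative_mult)
      (auto simp flip: frechet_derivative_works)
  then show ?case
    \<comment> \<open>The product rule leaves one factor undifferentiated in each summand, so the
      induction hypothesis also needs \<open>f\<close> and \<open>g\<close> themselves at the lower
      order.\<close>
    using Suc.prems times_cont_diff_Suc_imp [OF Suc.prems(1)]
      times_cont_diff_Suc_imp [OF Suc.prems(2)]
    by (simp add: Suc.IH times_cont_diff_add)
qed

lemma smooth_diff:
  assumes "smooth f" "smooth g"
  shows "smooth (\<lambda>x. f x - g x)"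
  using assms times_cont_diff_add [of _ f "\<lambda>x. - 1 * g x"] times_cont_diff_mult [of _ "\<lambda>x. - 1" g]
  unfolding smooth_def by simp

lemma smooth_mult: "smooth f \<Longrightarrow> smooth g \<Longrightarrow> smooth (\<lambda>x. f x * g x)"
  unfolding smooth_def by (simp add: times_cont_diff_mult)

lemma smooth_prod:
  assumes "\<And>i. i \<in> A \<Longrightarrow> smooth (f i)"
  shows "smooth (\<lambda>x. \<Prod>i\<in>A. f i x)"
  using assms
proof (induction A rule: infinite_finite_induct)
  case (insert i A)
  then show ?case by (simp add: smooth_mult)
qed (auto simp: smooth_def)

lemma smooth_imp_differentiable: "smooth f \<Longrightarrow> f differentiable (at x)"
  unfolding smooth_def by (metis times_cont_diff.simps(2))

lemma smooth_imp_continuous_on: "smooth f \<Longrightarrow> continuous_on S f"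
  unfolding smooth_def by (metis times_cont_diff.simps(1) continuous_on_subset subset_UNIV)

lemma smooth_imp_continuous_on_partial:
  "smooth f \<Longrightarrow> i \<in> Basis \<Longrightarrow> continuous_on S (\<lambda>x. frechet_derivative f (at x) i)"
  unfolding smooth_def
  by (metis times_cont_diff.simps continuous_on_subset subset_UNIV)

text \<open>The classical flat function exp(-1/t), extended by zero to t \<le> 0. The polynomial
  factor in 1/t is there to make the family closed under differentiation.\<close>

definition flat_exp :: "real poly \<Rightarrow> real \<Rightarrow> real" where
  "flat_exp p t = (if t \<le> 0 then 0 else poly p (inverse t) * exp (- inverse t))"

lemma poly_div_exp_tendsto_0: "((\<lambda>s. poly p s / exp s) \<longlongrightarrow> (0::real)) at_top"
proof -
  \<comment> \<open>The extra power carries the induction: \<open>pCons a p\<close> splits into a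
    monomial and \<open>s\<close> times \<open>p\<close>, which raises \<open>k\<close> by
    one.\<close>
  have "((\<lambda>s. s ^ k * poly p s / exp s) \<longlongrightarrow> (0::real)) at_top" for k
  proof (induction p arbitrary: k)
    case (pCons a p)
    have "((\<lambda>s. a * (s ^ k / exp s) + s ^ Suc k * poly p s / exp s) \<longlongrightarrow> a * 0 + 0) at_top"
      by (intro tendsto_intros tendsto_power_div_exp_0 pCons.IH)
    then show ?case
      by (simp add: algebra_simps add_divide_distrib)
  qed simp
  from this [of 0] show ?thesis by simp
qed

lemma flat_exp_tendsto_0: "(flat_exp p \<longlongrightarrow> 0) (at 0)"
proof (rule filterlim_split_at)
  have "eventually (\<lambda>t. flat_exp p t = 0) (at_left 0)"
    unfolding eventually_at_filter by (auto simp: flat_exp_def)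
  then show "(flat_exp p \<longlongrightarrow> 0) (at_left 0)"
    by (simp add: tendsto_eventually)
  have "((\<lambda>t. poly p (inverse t) / exp (inverse t)) \<longlongrightarrow> 0) (at_right 0)"
    by (rule filterlim_compose [OF poly_div_exp_tendsto_0 filterlim_inverse_at_top_right])
  moreover have "eventually (\<lambda>t. poly p (inverse t) / exp (inverse t) = flat_exp p t) (at_right 0)"
    unfolding eventually_at_filter by (auto simp: flat_exp_def exp_minus field_simps)
  ultimately show "(flat_exp p \<longlongrightarrow> 0) (at_right 0)"
    by (rule Lim_transform_eventually)
qed

text \<open>With \<open>s = 1 / t\<close>, the derivative of \<open>p s * exp (- s)\<close> in \<open>t\<close> is \<open>s\<^sup>2 * (p s - p' s) * exp (- s)\<close>.\<close>

definition flat_exp_deriv_poly :: "real poly \<Rightarrow> real poly" where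
  "flat_exp_deriv_poly p = pCons 0 (pCons 0 (p - pderiv p))"

lemma has_real_derivative_flat_exp:
  "(flat_exp p has_real_derivative flat_exp (flat_exp_deriv_poly p) t) (at t)"
proof -
  consider "t < 0" | "t = 0" | "t > 0" by linarith
  then show ?thesis
  proof cases
    case 1
    have "((\<lambda>_. 0) has_real_derivative 0) (at t)" by simp
    then have "(flat_exp p has_real_derivative 0) (at t)"
      by (rule has_field_derivative_transform_within_open [where S = "{..<0}"])
        (use 1 in \<open>auto simp: flat_exp_def\<close>)
    then show ?thesis using 1 by (simp add: flat_exp_def)
  next
    case 2
    \<comment> \<open>At the origin the difference quotient is again a flat function: dividing by
      \<open>h\<close> adds one factor 1/h, that is, replaces \<open>p\<close> by
      \<open>pCons 0 p\<close>.\<close>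
    have "eventually (\<lambda>h. flat_exp (pCons 0 p) h = (flat_exp p (0 + h) - flat_exp p 0) / h) (at 0)"
      unfolding eventually_at_filter by (auto simp: flat_exp_def field_simps)
    with flat_exp_tendsto_0 [of "pCons 0 p"]
    have "((\<lambda>h. (flat_exp p (0 + h) - flat_exp p 0) / h) \<longlongrightarrow> 0) (at 0)"
      by (rule Lim_transform_eventually)
    then show ?thesis using 2 by (simp add: DERIV_def flat_exp_def)
  next
    case 3
    have "((\<lambda>t. poly p (inverse t) * exp (- inverse t)) has_real_derivative
        flat_exp (flat_exp_deriv_poly p) t) (at t)"
      using 3
      by (auto intro!: derivative_eq_intros DERIV_chain2 [OF poly_DERIV]
          simp: flat_exp_def flat_exp_deriv_poly_def field_simps power2_eq_square)
    then show ?thesis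
      by (rule has_field_derivative_transform_within_open [where S = "{0<..}"])
        (use 3 in \<open>auto simp: flat_exp_def\<close>)
  qed
qed

lemma smooth_flat_exp: "smooth (\<lambda>x::'a::euclidean_space. flat_exp p (x \<bullet> v - c))"
proof -
  have "times_cont_diff m (\<lambda>x::'a. flat_exp p (x \<bullet> v - c))" for m
  \<comment> \<open>\<open>p\<close> has to vary because each partial derivative is a constant times
    the same kind of function with \<open>flat_exp_deriv_poly p\<close>.\<close>
  proof (induction m arbitrary: p)
    case 0
    have "continuous_on UNIV (flat_exp p)"
      by (rule DERIV_continuous_on [OF has_field_derivative_at_within])
        (rule has_real_derivative_flat_exp)
    then have "continuous_on UNIV (\<lambda>x::'a. flat_exp p (x \<bullet> v - c))"
      by (rule continuous_on_compose2) (auto intro!: continuous_intros)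
    then show ?case by simp
  next
    case (Suc m)
    let ?q = "flat_exp_deriv_poly p"
    have D: "((\<lambda>x::'a. flat_exp p (x \<bullet> v - c)) has_derivative
        (\<lambda>h. flat_exp ?q (x \<bullet> v - c) * (h \<bullet> v))) (at x)" for x
      by (rule has_derivative_compose
          [OF _ has_real_derivative_flat_exp [unfolded has_field_derivative_def]])
        (auto intro!: derivative_eq_intros)
    have "times_cont_diff m (\<lambda>x::'a. flat_exp ?q (x \<bullet> v - c) * (i \<bullet> v))" for i
      by (rule times_cont_diff_mult [OF Suc.IH]) simp
    then show ?case
      using D by (auto simp: differentiable_def simp flip: frechet_derivative_at [OF D])
  qed
  then show ?thesis by (simp add: smooth_def)
qed

text \<open>For fixed c > 0, exp(-1/(n c)) tends to 1 as n grows. The factor \<open>n\<close> thus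
  makes the bumps approach the indicator of the open box from below, while they all vanish outside
  it.\<close>

definition box_bump :: "'a::euclidean_space \<Rightarrow> 'a \<Rightarrow> nat \<Rightarrow> 'a \<Rightarrow> real" where
  "box_bump a b n x =
     (\<Prod>i\<in>Basis. flat_exp 1 (n * ((x - a) \<bullet> i)) * flat_exp 1 (n * ((b - x) \<bullet> i)))"

lemma smooth_box_bump: "smooth (box_bump a b n)"
proof -
  have "smooth (\<lambda>x. flat_exp 1 (n * ((x - a) \<bullet> i)) * flat_exp 1 (n * ((b - x) \<bullet> i)))" for i
    using smooth_mult [OF smooth_flat_exp [of 1 "n *\<^sub>R i" "n * (a \<bullet> i)"]
        smooth_flat_exp [of 1 "- (n *\<^sub>R i)" "- (n * (b \<bullet> i))"]]
    by (simp add: algebra_simps)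
  then show ?thesis
    unfolding box_bump_def [abs_def] by (rule smooth_prod)
qed

lemma flat_exp_1_bounds: "0 \<le> flat_exp 1 t" "flat_exp 1 t \<le> 1"
  by (auto simp: flat_exp_def)

lemma box_bump_bounds: "0 \<le> box_bump a b n x" "box_bump a b n x \<le> 1"
  unfolding box_bump_def
  by (auto intro!: prod_nonneg prod_le_1 mult_le_one simp: flat_exp_1_bounds)

lemma box_bump_outside:
  assumes "x \<notin> box a b"
  shows "box_bump a b n x = 0"
proof -
  obtain i where i: "i \<in> Basis" "x \<bullet> i \<le> a \<bullet> i \<or> b \<bullet> i \<le> x \<bullet> i"
    using assms by (auto simp: mem_box not_less)
  then have "flat_exp 1 (n * ((x - a) \<bullet> i)) * flat_exp 1 (n * ((b - x) \<bullet> i)) = 0"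
    by (auto simp: flat_exp_def inner_diff_left mult_le_0_iff)
  then show ?thesis
    unfolding box_bump_def using i by auto
qed

lemma flat_exp_1_tendsto_1:
  assumes "c > 0"
  shows "(\<lambda>n. flat_exp 1 (real n * c)) \<longlonglongrightarrow> 1"
proof (rule Lim_transform_eventually)
  have "(\<lambda>n. exp (- (inverse c * inverse (real n)))) \<longlonglongrightarrow> exp (- (inverse c * 0))"
    by (intro tendsto_intros lim_inverse_n)
  then show "(\<lambda>n. exp (- (inverse c * inverse (real n)))) \<longlonglongrightarrow> 1"
    by simp
  show "eventually (\<lambda>n. exp (- (inverse c * inverse (real n))) =
      flat_exp 1 (real n * c)) sequentially"
    using eventually_gt_at_top [of 0]
  proof eventually_elim
    case (elim n)
    then have "\<not> real n * c \<le> 0"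
      using assms by (simp add: mult_le_0_iff)
    then show ?case
      by (simp add: flat_exp_def)
  qed
qed

lemma box_bump_tendsto: "(\<lambda>n. box_bump a b n x) \<longlonglongrightarrow> indicator (box a b) x"
proof (cases "x \<in> box a b")
  case True
  have "(\<lambda>n. box_bump a b n x) \<longlonglongrightarrow> (\<Prod>i\<in>(Basis::'a set). 1 * 1)"
    unfolding box_bump_def
  proof (intro tendsto_prod tendsto_mult flat_exp_1_tendsto_1)
    fix i :: 'a
    assume "i \<in> Basis"
    then show "0 < (x - a) \<bullet> i" "0 < (b - x) \<bullet> i"
      using True by (simp_all add: mem_box inner_diff_left)
  qed
  then show ?thesis using True by simp
qed (simp add: box_bump_outside)

lemma box_bump_test_function:
  assumes "cbox a b \<subseteq> U"
  shows "box_bump a b n \<in> test_functions U"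
proof -
  have "\<forall>x. x \<notin> cbox a b \<longrightarrow> box_bump a b n x = 0"
    using box_bump_outside box_subset_cbox by (metis subsetD)
  with assms have "\<exists>K. compact K \<and> K \<subseteq> U \<and> (\<forall>x. x \<notin> K \<longrightarrow> box_bump a b n x = 0)"
    by (intro exI [of _ "cbox a b"]) simp
  then show ?thesis
    by (simp add: test_functions_def smooth_box_bump)
qed

section \<open>Square integrable functions\<close>

text \<open>Expanding the square of \<open>t *\<^sub>R a - b\<close> and dividing by
  \<open>t\<close> bounds the cross term. The weight is kept free: t = 1 gives closure of
  \<open>L2\<close> under differences, the optimal t gives the triangle inequality.\<close>

lemma norm_add_sq_le:
  fixes a b :: "'c::real_inner"
  assumes "t > 0"
  shows "(norm (a + b))\<^sup>2 \<le> (1 + t) * (norm a)\<^sup>2 + (1 + 1 / t) * (norm b)\<^sup>2"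
proof -
  have "0 \<le> (norm (t *\<^sub>R a - b))\<^sup>2 / t"
    using assms by simp
  also have "\<dots> = t * (norm a)\<^sup>2 - 2 * (a \<bullet> b) + (norm b)\<^sup>2 / t"
    using assms unfolding power2_norm_eq_inner
    by (simp add: inner_diff_left inner_diff_right inner_commute field_simps)
  finally show ?thesis
    unfolding power2_norm_eq_inner
    by (simp add: inner_add_left inner_add_right inner_commute algebra_simps)
qed

lemma norm_diff_sq_le:
  fixes a b :: "'c::real_inner"
  assumes "t > 0"
  shows "(norm (a - b))\<^sup>2 \<le> (1 + t) * (norm a)\<^sup>2 + (1 + 1 / t) * (norm b)\<^sup>2"
  using norm_add_sq_le [OF assms, of a "- b"] by simp

lemma L2_measurable [measurable_dest]: "f \<in> L2 M \<Longrightarrow> f \<in> borel_measurable M"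
  by (simp add: L2_def)

lemma L2_integrable: "f \<in> L2 M \<Longrightarrow> integrable M (\<lambda>x. (norm (f x))\<^sup>2)"
  by (simp add: L2_def)

lemma L2_diff:
  assumes [measurable]: "f \<in> L2 M" "g \<in> L2 M"
  shows "(\<lambda>x. f x - g x) \<in> L2 M"
proof -
  have "integrable M (\<lambda>x. 2 * (norm (f x))\<^sup>2 + 2 * (norm (g x))\<^sup>2)"
    using assms by (simp add: L2_integrable)
  then have "integrable M (\<lambda>x. (norm (f x - g x))\<^sup>2)"
  proof (rule Bochner_Integration.integrable_bound)
    have "(norm (f x - g x))\<^sup>2 \<le> 2 * (norm (f x))\<^sup>2 + 2 * (norm (g x))\<^sup>2" for x
      using norm_diff_sq_le [of 1 "f x" "g x"] by simp
    then show "AE x in M. norm ((norm (f x - g x))\<^sup>2) \<le>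
        norm (2 * (norm (f x))\<^sup>2 + 2 * (norm (g x))\<^sup>2)"
      by (intro AE_I2) simp
  qed measurable
  then show ?thesis by (simp add: L2_def)
qed

lemma L2_inner_integrable:
  assumes [measurable]: "f \<in> L2 M" "g \<in> L2 M"
  shows "integrable M (\<lambda>x. f x \<bullet> g x)"
proof (rule Bochner_Integration.integrable_bound)
  show "integrable M (\<lambda>x. (norm (f x))\<^sup>2 + (norm (g x))\<^sup>2)"
    using assms by (simp add: L2_integrable)
  have "\<bar>f x \<bullet> g x\<bar> \<le> (norm (f x))\<^sup>2 + (norm (g x))\<^sup>2" for x
  proof -
    have "0 \<le> norm (f x) * norm (g x)" by simp
    with Cauchy_Schwarz_ineq2 [of "f x" "g x"] sum_squares_bound [of "norm (f x)" "norm (g x)"]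
    show ?thesis by linarith
  qed
  then show "AE x in M. norm (f x \<bullet> g x) \<le> norm ((norm (f x))\<^sup>2 + (norm (g x))\<^sup>2)"
    by (intro AE_I2) simp
qed measurable

lemma L2_mult_integrable:
  fixes f g :: "'b \<Rightarrow> real"
  shows "f \<in> L2 M \<Longrightarrow> g \<in> L2 M \<Longrightarrow> integrable M (\<lambda>x. f x * g x)"
  using L2_inner_integrable [of f M g] by simp

lemma L2_inner_const:
  assumes [measurable]: "f \<in> L2 M"
  shows "(\<lambda>x. f x \<bullet> c) \<in> L2 M"
proof -
  have "integrable M (\<lambda>x. (norm (f x))\<^sup>2 * (norm c)\<^sup>2)"
    using assms by (simp add: L2_integrable)
  then have "integrable M (\<lambda>x. (norm (f x \<bullet> c))\<^sup>2)"
  proof (rule Bochner_Integration.integrable_bound)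
    have "(norm (f x \<bullet> c))\<^sup>2 \<le> (norm (f x) * norm c)\<^sup>2" for x
      by (rule power_mono) (simp_all add: Cauchy_Schwarz_ineq2)
    then show "AE x in M. norm ((norm (f x \<bullet> c))\<^sup>2) \<le> norm ((norm (f x))\<^sup>2 * (norm c)\<^sup>2)"
      by (intro AE_I2) (simp add: power_mult_distrib)
  qed measurable
  then show ?thesis by (simp add: L2_def)
qed

lemma L2_norm_nonneg: "0 \<le> L2_norm M f"
  by (simp add: L2_norm_def)

lemma L2_norm_sq: "(L2_norm M f)\<^sup>2 = (\<integral>x. (norm (f x))\<^sup>2 \<partial>M)"
  by (simp add: L2_norm_def)

lemma L2_norm_cong_AE:
  assumes "f \<in> borel_measurable M" "g \<in> borel_measurable M" "AE x in M. f x = g x"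
  shows "L2_norm M f = L2_norm M g"
  unfolding L2_norm_def using assms by (intro arg_cong [where f = sqrt] integral_cong_AE) auto

lemma L2_norm_triangle_diff:
  assumes "f \<in> L2 M" "g \<in> L2 M"
  shows "L2_norm M (\<lambda>x. f x - g x) \<le> L2_norm M f + L2_norm M g"
proof (rule field_le_epsilon)
  fix e :: real
  assume "e > 0"
  \<comment> \<open>The summands \<open>e / 2\<close> keep the weight t = b/a defined and positive
    even if a norm vanishes. For this t the bound (1 + b/a) a^2 + (1 + a/b) b^2 is exactly (a +
    b)^2.\<close>
  define a b where "a = L2_norm M f + e / 2" and "b = L2_norm M g + e / 2"
  have pos: "a > 0" "b > 0"
    using \<open>e > 0\<close> L2_norm_nonneg [of M f] L2_norm_nonneg [of M g] by (simp_all add: a_def b_def)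
  have sq: "(L2_norm M f)\<^sup>2 \<le> a\<^sup>2" "(L2_norm M g)\<^sup>2 \<le> b\<^sup>2"
    using \<open>e > 0\<close> by (auto intro!: power_mono L2_norm_nonneg simp: a_def b_def)
  have "(L2_norm M (\<lambda>x. f x - g x))\<^sup>2 \<le>
      (\<integral>x. (1 + b / a) * (norm (f x))\<^sup>2 + (1 + a / b) * (norm (g x))\<^sup>2 \<partial>M)"
    unfolding L2_norm_sq
    using norm_diff_sq_le [of "b / a"] pos assms
    by (intro integral_mono Bochner_Integration.integrable_add integrable_mult_right)
      (auto intro: L2_integrable L2_diff)
  also have "\<dots> = (1 + b / a) * (L2_norm M f)\<^sup>2 + (1 + a / b) * (L2_norm M g)\<^sup>2"
    using assms by (simp add: L2_norm_sq L2_integrable)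
  also have "\<dots> \<le> (1 + b / a) * a\<^sup>2 + (1 + a / b) * b\<^sup>2"
    using sq pos by (intro add_mono mult_left_mono) auto
  also have "\<dots> = (a + b)\<^sup>2"
    using pos by (simp add: field_simps power2_eq_square)
  finally have "L2_norm M (\<lambda>x. f x - g x) \<le> a + b"
    by (rule power2_le_imp_le) (use pos in simp)
  then show "L2_norm M (\<lambda>x. f x - g x) \<le> L2_norm M f + L2_norm M g + e"
    by (simp add: a_def b_def)
qed

section \<open>Weak gradients\<close>

text \<open>A continuous function vanishing off a compact set is square integrable, and the partial
  derivatives of a test function inherit its compact support.\<close>

lemma test_functions_L2:
  assumes "open U" "\<phi> \<in> test_functions U"
  shows "\<phi> \<in> L2 (lebesgue_on U)"
    and "i \<in> Basis \<Longrightarrow> (\<lambda>x. frechet_derivative \<phi> (at x) i) \<in> L2 (lebesgue_on U)"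
proof -
  obtain K where K: "compact K" "K \<subseteq> U" "\<And>x. x \<notin> K \<Longrightarrow> \<phi> x = 0" and \<phi>: "smooth \<phi>"
    using assms(2) by (auto simp: test_functions_def)
  have L2: "g \<in> L2 (lebesgue_on U)"
    if g: "continuous_on UNIV g" "\<And>x. x \<notin> K \<Longrightarrow> g x = 0" for g :: "'a \<Rightarrow> real"
  proof -
    have U: "U \<in> sets lebesgue"
      using assms(1) by (simp add: borel_open)
    have "g \<in> borel_measurable (lebesgue_on U)"
      using g(1) U continuous_imp_measurable_on_sets_lebesgue continuous_on_subset by blast
    moreover have "integrable (lebesgue_on U) (\<lambda>x. (norm (g x))\<^sup>2)"
    proof -
      have "continuous_on K (\<lambda>x. (norm (g x))\<^sup>2)"
        by (intro continuous_intros continuous_on_subset [OF g(1)]) simp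
      then have "integrable lebesgue (\<lambda>x. indicator K x *\<^sub>R (norm (g x))\<^sup>2)"
        using borel_integrable_compact [OF K(1)]
        by (intro integrable_completion [THEN iffD2] borel_measurable_integrable)
      moreover have "(\<lambda>x. indicator K x *\<^sub>R (norm (g x))\<^sup>2) =
          (\<lambda>x. indicator U x *\<^sub>R (norm (g x))\<^sup>2)"
        using K(2) g(2) by (auto simp: fun_eq_iff indicator_def)
      ultimately show ?thesis
        using U by (simp add: integrable_restrict_space)
    qed
    ultimately show ?thesis by (simp add: L2_def)
  qed
  show "\<phi> \<in> L2 (lebesgue_on U)"
    using L2 K \<phi> smooth_imp_continuous_on by blast
  have zero: "frechet_derivative \<phi> (at x) = (\<lambda>_. 0)" if "x \<notin> K" for x
  proof -
    have "(\<phi> has_derivative (\<lambda>_. 0)) (at x)"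
      by (rule has_derivative_transform_within_open [of "\<lambda>_. 0" _ _ _ "- K"])
        (use that K compact_imp_closed in auto)
    then show ?thesis
      by (metis frechet_derivative_at)
  qed
  show "(\<lambda>x. frechet_derivative \<phi> (at x) i) \<in> L2 (lebesgue_on U)" if "i \<in> Basis"
    by (rule L2) (use that \<phi> zero smooth_imp_continuous_on_partial in auto)
qed

text \<open>
  The bumps converge boundedly to the indicator of a box, so that \<open>g\<close> integrates to zero over every
  box in \<open>U\<close>; differentiating over shrinking cubes recovers \<open>g\<close> almost everywhere.
\<close>

lemma integral_test_functions_eq_0_imp_AE:
  fixes g :: "'a::euclidean_space \<Rightarrow> real"
  assumes "open U" and g: "g \<in> L2 (lebesgue_on U)"
    and zero: "\<And>\<phi>. \<phi> \<in> test_functions U \<Longrightarrow> (\<integral>x. g x * \<phi> x \<partial>lebesgue_on U) = 0"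
  shows "AE x in lebesgue_on U. g x = 0"
proof -
  have U [measurable]: "U \<in> sets lebesgue"
    using assms(1) by (simp add: borel_open)
  \<comment> \<open>Extension by zero moves the problem to the whole space, where the gauge integral
    and the differentiation theorem are available.\<close>
  define f where "f x = (if x \<in> U then g x else 0)" for x
  have f_ind: "f = (\<lambda>x. indicator U x *\<^sub>R g x)"
    by (auto simp: f_def fun_eq_iff)
  have f_meas [measurable]: "f \<in> borel_measurable lebesgue"
    using L2_measurable [OF g] U unfolding f_ind
    by (subst (asm) borel_measurable_restrict_space_iff) (auto simp: mult.commute)
  have "integrable lebesgue (\<lambda>x. indicator U x *\<^sub>R (norm (g x))\<^sup>2)"
    using L2_integrable [OF g] U by (simp add: integrable_restrict_space)
  moreover have "(\<lambda>x. indicator U x *\<^sub>R (norm (g x))\<^sup>2) = (\<lambda>x. (f x)\<^sup>2)"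
    by (auto simp: f_def fun_eq_iff)
  ultimately have f_sq: "integrable lebesgue (\<lambda>x. (f x)\<^sup>2)"
    by simp
  \<comment> \<open>Square integrability gives integrability on bounded boxes only, through
    \<bar>f\<bar> \<le> f^2 + 1 there.\<close>
  have f_box: "integrable lebesgue (\<lambda>x. indicator (cbox a b) x * f x)" for a b
  proof (rule Bochner_Integration.integrable_bound)
    show "integrable lebesgue (\<lambda>x. (f x)\<^sup>2 + indicator (cbox a b) x)"
      using f_sq by (intro Bochner_Integration.integrable_add integrable_real_indicator) (auto simp: emeasure_lborel_cbox_eq)
    have "\<bar>indicator (cbox a b) x * f x\<bar> \<le> (f x)\<^sup>2 + indicator (cbox a b) x" for x
    proof -
      have "0 \<le> (\<bar>f x\<bar> - 1)\<^sup>2" by simp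
      then have "2 * \<bar>f x\<bar> \<le> (f x)\<^sup>2 + 1"
        by (simp add: power2_diff)
      then show ?thesis by (auto simp: indicator_def)
    qed
    then show "AE x in lebesgue. norm (indicator (cbox a b) x * f x) \<le>
        norm ((f x)\<^sup>2 + indicator (cbox a b) x)"
      by (intro AE_I2) (smt (verit) real_norm_def)
  qed (intro borel_measurable_times borel_measurable_indicator f_meas; simp)
  have ind_if: "(\<lambda>x. indicator S x * f x) = (\<lambda>x. if x \<in> S then f x else 0)" for S
    by (auto simp: fun_eq_iff)
  have f_cbox: "f integrable_on cbox a b" for a b
    using integrable_on_lebesgue [OF f_box [of a b]]
    by (simp add: ind_if Henstock_Kurzweil_Integration.integrable_restrict_UNIV)
  have integral_0: "integral (cbox a b) f = 0" if ab: "cbox a b \<subseteq> U" for a b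
  proof -
    \<comment> \<open>Dominated convergence: the bumps are at most 1 and live in the box, so
      \<open>f\<close> cut off to \<open>cbox a b\<close> dominates. Each integral on the left is
      zero since the bumps are test functions of \<open>U\<close>.\<close>
    have "(\<lambda>n. \<integral>x. f x * box_bump a b n x \<partial>lebesgue) \<longlonglongrightarrow>
        (\<integral>x. f x * indicator (box a b) x \<partial>lebesgue)"
    proof (rule integral_dominated_convergence)
      show "integrable lebesgue (\<lambda>x. \<bar>indicator (cbox a b) x * f x\<bar>)"
        using f_box by (rule integrable_abs)
      show "(\<lambda>x. f x * indicator (box a b) x) \<in> borel_measurable lebesgue"
        by (intro borel_measurable_times borel_measurable_indicator f_meas) simp
      have "box_bump a b n \<in> borel_measurable lebesgue" for n
        by (intro measurable_completion)
          (simp add: borel_measurable_continuous_onI smooth_imp_continuous_on smooth_box_bump)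
      then show "(\<lambda>x. f x * box_bump a b n x) \<in> borel_measurable lebesgue" for n
        by (intro borel_measurable_times f_meas)
      show "AE x in lebesgue. (\<lambda>n. f x * box_bump a b n x) \<longlonglongrightarrow> f x * indicator (box a b) x"
        by (intro AE_I2 tendsto_mult tendsto_const box_bump_tendsto)
      have "\<bar>f x * box_bump a b n x\<bar> \<le> \<bar>indicator (cbox a b) x * f x\<bar>" for n x
      proof (cases "x \<in> box a b")
        case True
        then show ?thesis
          using box_bump_bounds [of a b n x] box_subset_cbox [of a b]
          by (auto simp: abs_mult mult_left_le)
      qed (simp add: box_bump_outside)
      then show "AE x in lebesgue. norm (f x * box_bump a b n x) \<le>
          \<bar>indicator (cbox a b) x * f x\<bar>" for n
        by (intro AE_I2) simp
    qed
    moreover have "(\<integral>x. f x * box_bump a b n x \<partial>lebesgue) = 0" for n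
    proof -
      have "(\<integral>x. f x * box_bump a b n x \<partial>lebesgue) =
          (\<integral>x. g x * box_bump a b n x \<partial>lebesgue_on U)"
        using U by (simp add: integral_restrict_space f_ind mult.assoc)
      then show ?thesis
        using zero [OF box_bump_test_function [OF ab]] by simp
    qed
    ultimately have "(\<integral>x. f x * indicator (box a b) x \<partial>lebesgue) = 0"
      using LIMSEQ_unique tendsto_const by (metis (no_types, lifting) ext)
    then have "(\<integral>x. indicator (box a b) x * f x \<partial>lebesgue) = 0"
      by (simp add: mult.commute)
    moreover have "integrable lebesgue (\<lambda>x. indicator (box a b) x * f x)"
    proof (rule Bochner_Integration.integrable_bound [OF f_box [of a b]])
      show "(\<lambda>x. indicator (box a b) x * f x) \<in> borel_measurable lebesgue"
        by (intro borel_measurable_times borel_measurable_indicator f_meas) simp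
      show "AE x in lebesgue. norm (indicator (box a b) x * f x) \<le>
          norm (indicator (cbox a b) x * f x)"
        using box_subset_cbox [of a b] by (intro AE_I2) (auto simp: indicator_def)
    qed
    \<comment> \<open>For the gauge integral the open and the closed box give the same
      value.\<close>
    ultimately have "integral UNIV (\<lambda>x. indicator (box a b) x * f x) = 0"
      using has_integral_integral_lebesgue integral_unique by metis
    then show ?thesis
      by (simp add: ind_if Henstock_Kurzweil_Integration.integral_restrict_UNIV
          integral_open_interval)
  qed
  \<comment> \<open>Lebesgue differentiation: off a null set, averages over cubes with lower corner
    \<open>x\<close> converge to \<open>f x\<close>.\<close>
  obtain N where N: "negligible N"
    and lim: "\<And>x e. x \<notin> N \<Longrightarrow> 0 < e \<Longrightarrow> \<exists>d>0. \<forall>h. 0 < h \<and> h < d \<longrightarrow>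
        norm (integral (cbox x (x + h *\<^sub>R One)) f /\<^sub>R h ^ DIM('a) - f x) < e"
    using integrable_ccontinuous_explicit [OF f_cbox] by metis
  have "f x = 0" if x: "x \<in> U" "x \<notin> N" for x
  proof (rule ccontr)
    assume "f x \<noteq> 0"
    \<comment> \<open>With tolerance \<bar>f x\<bar>, an average equal to zero would yield \<bar>f
      x\<bar> < \<bar>f x\<bar>.\<close>
    then obtain d where d: "d > 0" "\<And>h. 0 < h \<Longrightarrow> h < d \<Longrightarrow>
        norm (integral (cbox x (x + h *\<^sub>R One)) f /\<^sub>R h ^ DIM('a) - f x) < \<bar>f x\<bar>"
      using lim [OF x(2), of "\<bar>f x\<bar>"] by auto
    obtain r where r: "r > 0" "cball x r \<subseteq> U"
      using assms(1) x(1) open_contains_cball by blast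
    \<comment> \<open>\<open>d / 2\<close> keeps \<open>h\<close> below \<open>d\<close>. Dividing
      \<open>r\<close> by the dimension makes the l1 bound on the cube at most \<open>r\<close>, so
      that the cube stays in the ball inside \<open>U\<close>.\<close>
    define h where "h = min (d / 2) (r / DIM('a))"
    have h: "0 < h" "h < d" "h * DIM('a) \<le> r"
      using d(1) r(1) by (auto simp: h_def min_def field_simps)
    have "cbox x (x + h *\<^sub>R One) \<subseteq> cball x r"
    proof
      fix y
      assume y: "y \<in> cbox x (x + h *\<^sub>R One)"
      have "norm (y - x) \<le> (\<Sum>i\<in>Basis. \<bar>(y - x) \<bullet> i\<bar>)"
        by (rule norm_le_l1)
      also have "\<dots> \<le> (\<Sum>i\<in>(Basis::'a set). h)"
        using y by (intro sum_mono) (auto simp: mem_box inner_diff_left inner_add_left)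
      also have "\<dots> \<le> r"
        using h(3) by (simp add: mult.commute)
      finally show "y \<in> cball x r"
        by (simp add: dist_norm norm_minus_commute)
    qed
    then have "integral (cbox x (x + h *\<^sub>R One)) f = 0"
      using r(2) by (intro integral_0) auto
    then show False
      using d(2) [OF h(1,2)] by simp
  qed
  then have "\<forall>x\<in>U. x \<notin> N \<longrightarrow> g x = 0"
    by (auto simp: f_def)
  moreover have "AE x in lebesgue. x \<notin> N"
    using N by (simp add: negligible_iff_null_sets AE_not_in)
  ultimately show ?thesis
    using U by (subst AE_restrict_space_iff) (auto elim: eventually_mono)
qed

text \<open>The \<open>L2\<close> hypotheses make every integrand integrable; without integrability
  the Bochner integral takes a default value and need not be additive.\<close>

lemma weak_gradient_diff:
  assumes "open U"
    and "w \<in> L2 (lebesgue_on U)" "G \<in> L2 (lebesgue_on U)" "weak_gradient U w G"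
    and "w' \<in> L2 (lebesgue_on U)" "G' \<in> L2 (lebesgue_on U)" "weak_gradient U w' G'"
  shows "weak_gradient U (\<lambda>x. w x - w' x) (\<lambda>x. G x - G' x)"
  unfolding weak_gradient_def
proof (intro ballI)
  fix \<phi> and i :: 'a
  assume \<phi>: "\<phi> \<in> test_functions U" and i: "i \<in> Basis"
  note T = test_functions_L2 [OF assms(1) \<phi>]
  let ?\<phi>i = "\<lambda>x. frechet_derivative \<phi> (at x) i"
  have "integrable (lebesgue_on U) (\<lambda>x. w x * ?\<phi>i x)" "integrable (lebesgue_on U) (\<lambda>x. w' x * ?\<phi>i x)"
    "integrable (lebesgue_on U) (\<lambda>x. (G x \<bullet> i) * \<phi> x)"
    "integrable (lebesgue_on U) (\<lambda>x. (G' x \<bullet> i) * \<phi> x)"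
    using assms T i by (auto intro: L2_mult_integrable L2_inner_const)
  moreover have "(\<integral>x. w x * ?\<phi>i x \<partial>lebesgue_on U) = - (\<integral>x. (G x \<bullet> i) * \<phi> x \<partial>lebesgue_on U)"
    "(\<integral>x. w' x * ?\<phi>i x \<partial>lebesgue_on U) = - (\<integral>x. (G' x \<bullet> i) * \<phi> x \<partial>lebesgue_on U)"
    using assms(4,7) \<phi> i by (auto simp: weak_gradient_def)
  ultimately show "(\<integral>x. (w x - w' x) * ?\<phi>i x \<partial>lebesgue_on U) =
      - (\<integral>x. ((G x - G' x) \<bullet> i) * \<phi> x \<partial>lebesgue_on U)"
    by (simp add: left_diff_distrib inner_diff_left)
qed

text \<open>Each coordinate of \<open>G - G'\<close> integrates to zero against all test functions,
  hence vanishes almost everywhere; finitely many coordinates combine.\<close>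

lemma weak_gradient_unique:
  assumes "open U" "G \<in> L2 (lebesgue_on U)" "G' \<in> L2 (lebesgue_on U)"
    and "weak_gradient U w G" "weak_gradient U w G'"
  shows "AE x in lebesgue_on U. G x = G' x"
proof -
  have "AE x in lebesgue_on U. (G x - G' x) \<bullet> i = 0" if i: "i \<in> Basis" for i
  proof (rule integral_test_functions_eq_0_imp_AE [OF assms(1)])
    show "(\<lambda>x. (G x - G' x) \<bullet> i) \<in> L2 (lebesgue_on U)"
      using assms by (intro L2_inner_const L2_diff)
    fix \<phi>
    assume \<phi>: "\<phi> \<in> test_functions U"
    have "integrable (lebesgue_on U) (\<lambda>x. (G x \<bullet> i) * \<phi> x)"
      "integrable (lebesgue_on U) (\<lambda>x. (G' x \<bullet> i) * \<phi> x)"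
      using assms test_functions_L2 [OF assms(1) \<phi>]
      by (auto intro: L2_mult_integrable L2_inner_const)
    then show "(\<integral>x. (G x - G' x) \<bullet> i * \<phi> x \<partial>lebesgue_on U) = 0"
      using assms(4,5) \<phi> i by (simp add: weak_gradient_def inner_diff_left left_diff_distrib)
  qed
  then have "AE x in lebesgue_on U. \<forall>i\<in>Basis. (G x - G' x) \<bullet> i = 0"
    by (simp add: AE_ball_countable countable_finite)
  then show ?thesis
    by eventually_elim (auto intro: euclidean_eqI simp: inner_diff_left)
qed

section \<open>The space \<open>H1\<close>, the Dirichlet form and the associated seminorm\<close>

lemma H1_imp_L2: "w \<in> H1 U \<Longrightarrow> w \<in> L2 (lebesgue_on U)"
  by (simp add: H1_def)

lemma wgrad_works:
  assumes "w \<in> H1 U"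
  shows "wgrad U w \<in> L2 (lebesgue_on U)" "weak_gradient U w (wgrad U w)"
proof -
  have "\<exists>G. G \<in> L2 (lebesgue_on U) \<and> weak_gradient U w G"
    using assms by (auto simp: H1_def)
  then have "wgrad U w \<in> L2 (lebesgue_on U) \<and> weak_gradient U w (wgrad U w)"
    unfolding wgrad_def by (rule someI_ex)
  then show "wgrad U w \<in> L2 (lebesgue_on U)" "weak_gradient U w (wgrad U w)"
    by auto
qed

lemma H1_diff:
  assumes "open U" "w \<in> H1 U" "v \<in> H1 U"
  shows "(\<lambda>x. w x - v x) \<in> H1 U"
  using weak_gradient_diff [OF assms(1) H1_imp_L2 wgrad_works H1_imp_L2 wgrad_works] assms
  by (auto simp: H1_def intro!: L2_diff bexI wgrad_works)

text \<open>The choice in \<open>wgrad\<close> need not respect subtraction pointwise, but both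
  sides are weak gradients of the same function, so uniqueness applies.\<close>

lemma wgrad_diff:
  assumes "open U" "w \<in> H1 U" "v \<in> H1 U"
  shows "AE x in lebesgue_on U. wgrad U (\<lambda>x. w x - v x) x = wgrad U w x - wgrad U v x"
  using assms
  by (intro weak_gradient_unique [OF assms(1)])
    (auto intro!: wgrad_works H1_diff L2_diff weak_gradient_diff H1_imp_L2)

lemma dirichlet_form_commute: "dirichlet_form U w v = dirichlet_form U v w"
  by (simp add: dirichlet_form_def inner_commute)

lemma dirichlet_form_diff_left:
  assumes "open U" "w \<in> H1 U" "v \<in> H1 U" "z \<in> H1 U"
  shows "dirichlet_form U (\<lambda>x. w x - v x) z = dirichlet_form U w z - dirichlet_form U v z"
proof -
  have m: "wgrad U y \<in> borel_measurable (lebesgue_on U)" if "y \<in> H1 U" for y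
    using wgrad_works(1) [OF that] by (rule L2_measurable)
  have [measurable]: "wgrad U (\<lambda>x. w x - v x) \<in> borel_measurable (lebesgue_on U)"
    "wgrad U w \<in> borel_measurable (lebesgue_on U)" "wgrad U v \<in> borel_measurable (lebesgue_on U)"
    "wgrad U z \<in> borel_measurable (lebesgue_on U)"
    using assms by (auto intro!: m H1_diff)
  have "dirichlet_form U (\<lambda>x. w x - v x) z =
      (\<integral>x. (wgrad U w x - wgrad U v x) \<bullet> wgrad U z x \<partial>lebesgue_on U)"
    unfolding dirichlet_form_def
  proof (rule integral_cong_AE)
    show "AE x in lebesgue_on U. wgrad U (\<lambda>x. w x - v x) x \<bullet> wgrad U z x =
        (wgrad U w x - wgrad U v x) \<bullet> wgrad U z x"
      using wgrad_diff [OF assms(1-3)] by eventually_elim simp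
  qed measurable
  also have "\<dots> = dirichlet_form U w z - dirichlet_form U v z"
    using assms unfolding dirichlet_form_def
    by (simp add: inner_diff_left L2_inner_integrable wgrad_works)
  finally show ?thesis .
qed

lemma dirichlet_form_diff_right:
  assumes "open U" "w \<in> H1 U" "v \<in> H1 U" "z \<in> H1 U"
  shows "dirichlet_form U z (\<lambda>x. w x - v x) = dirichlet_form U z w - dirichlet_form U z v"
  using dirichlet_form_diff_left [OF assms] by (simp add: dirichlet_form_commute)

lemma H1_seminorm_eq_sqrt: "H1_seminorm U w = sqrt (dirichlet_form U w w)"
  by (simp add: H1_seminorm_def L2_norm_def dirichlet_form_def power2_norm_eq_inner)

lemma dirichlet_form_nonneg: "0 \<le> dirichlet_form U w w"
  by (simp add: dirichlet_form_def)

lemma H1_seminorm_minus_commute: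
  assumes "open U" "w \<in> H1 U" "v \<in> H1 U"
  shows "H1_seminorm U (\<lambda>x. w x - v x) = H1_seminorm U (\<lambda>x. v x - w x)"
  using assms
  by (simp add: H1_seminorm_eq_sqrt dirichlet_form_diff_left dirichlet_form_diff_right H1_diff)

lemma H1_seminorm_triangle_diff:
  assumes "open U" "w \<in> H1 U" "v \<in> H1 U"
  shows "H1_seminorm U (\<lambda>x. w x - v x) \<le> H1_seminorm U w + H1_seminorm U v"
proof -
  have "H1_seminorm U (\<lambda>x. w x - v x) =
      L2_norm (lebesgue_on U) (\<lambda>x. wgrad U w x - wgrad U v x)"
    unfolding H1_seminorm_def using assms
    by (intro L2_norm_cong_AE wgrad_diff)
      (auto intro!: L2_measurable wgrad_works H1_diff L2_diff)
  also have "\<dots> \<le> H1_seminorm U w + H1_seminorm U v"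
    unfolding H1_seminorm_def using assms by (intro L2_norm_triangle_diff wgrad_works)
  finally show ?thesis .
qed

lemma H1_norm_nonneg: "0 \<le> H1_norm U w"
  by (simp add: H1_norm_def)

text \<open>The triangle inequalities of the two components combine by the Euclidean one in the
  plane.\<close>

lemma H1_norm_triangle_diff:
  assumes "open U" "w \<in> H1 U" "v \<in> H1 U"
  shows "H1_norm U (\<lambda>x. w x - v x) \<le> H1_norm U w + H1_norm U v"
proof -
  have "H1_norm U (\<lambda>x. w x - v x) \<le>
      sqrt ((L2_norm (lebesgue_on U) w + L2_norm (lebesgue_on U) v)\<^sup>2 +
        (H1_seminorm U w + H1_seminorm U v)\<^sup>2)"
    unfolding H1_norm_def using assms
    by (intro real_sqrt_le_mono add_mono power_mono L2_norm_triangle_diff H1_seminorm_triangle_diff)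
      (auto simp: H1_imp_L2 L2_norm_nonneg H1_seminorm_def)
  also have "\<dots> \<le> H1_norm U w + H1_norm U v"
    unfolding H1_norm_def by (rule real_sqrt_sum_squares_triangle_ineq)
  finally show ?thesis .
qed

section \<open>Traces on facets\<close>

lemma has_trace_cong:
  assumes "has_trace U L w g" "\<And>x. x \<in> L \<Longrightarrow> g x = g' x"
  shows "has_trace U L w g'"
proof -
  \<comment> \<open>The facet measure is restricted to \<open>L\<close>, so the values of
    \<open>g\<close> off \<open>L\<close> are invisible to it.\<close>
  have space: "x \<in> L" if "x \<in> space (facet_measure L)" for x
    using that by (auto simp: facet_measure_def Let_def space_restrict_space)
  have "g' \<in> L2 (facet_measure L)"
    using assms space
    by (auto simp: has_trace_def L2_def cong: measurable_cong Bochner_Integration.integrable_cong)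
  moreover have "L2_norm (facet_measure L) (\<lambda>x. \<psi> x - g x) =
      L2_norm (facet_measure L) (\<lambda>x. \<psi> x - g' x)" for \<psi>
    unfolding L2_norm_def using assms(2) space
    by (intro arg_cong [where f = sqrt] Bochner_Integration.integral_cong) auto
  ultimately show ?thesis
    using assms(1) by (simp add: has_trace_def)
qed

text \<open>Subtracting the two approximating sequences termwise gives one for the difference; the
  triangle inequality controls both limits.\<close>

lemma has_trace_diff:
  assumes "open U" "has_trace U L w g" "has_trace U L w' g'"
  shows "has_trace U L (\<lambda>x. w x - w' x) (\<lambda>x. g x - g' x)"
proof -
  let ?M = "facet_measure L"
  obtain \<phi> where \<phi>: "\<And>m. smooth (\<phi> m)" "\<And>m. \<phi> m \<in> H1 U" "\<And>m. \<phi> m \<in> L2 ?M"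
    and \<phi>_lim: "(\<lambda>m. H1_norm U (\<lambda>x. \<phi> m x - w x)) \<longlonglongrightarrow> 0" "(\<lambda>m. L2_norm ?M (\<lambda>x. \<phi> m x - g x)) \<longlonglongrightarrow> 0"
    using assms(2) unfolding has_trace_def by blast
  obtain \<psi> where \<psi>: "\<And>m. smooth (\<psi> m)" "\<And>m. \<psi> m \<in> H1 U" "\<And>m. \<psi> m \<in> L2 ?M"
    and \<psi>_lim: "(\<lambda>m. H1_norm U (\<lambda>x. \<psi> m x - w' x)) \<longlonglongrightarrow> 0" "(\<lambda>m. L2_norm ?M (\<lambda>x. \<psi> m x - g' x)) \<longlonglongrightarrow> 0"
    using assms(3) unfolding has_trace_def by blast
  have w: "w \<in> H1 U" "w' \<in> H1 U" and g: "g \<in> L2 ?M" "g' \<in> L2 ?M"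
    using assms by (auto simp: has_trace_def)
  \<comment> \<open>Regroups the error of the difference as the difference of the errors. Fixing the
    second term as a value of \<psi> when unfolding prevents the rewriting from looping.\<close>
  have swap: "a - b - (c - d) = a - c - (b - d)" for a b c d :: real
    by simp
  have "(\<lambda>m. H1_norm U (\<lambda>x. \<phi> m x - \<psi> m x - (w x - w' x))) \<longlonglongrightarrow> 0"
  proof (rule tendsto_sandwich [OF _ _ tendsto_const])
    show "\<forall>\<^sub>F m in sequentially. H1_norm U (\<lambda>x. \<phi> m x - \<psi> m x - (w x - w' x)) \<le>
        H1_norm U (\<lambda>x. \<phi> m x - w x) + H1_norm U (\<lambda>x. \<psi> m x - w' x)"
      unfolding swap [of _ "\<psi> _ _"] using assms(1) \<phi> \<psi> w
      by (intro always_eventually allI H1_norm_triangle_diff H1_diff)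
    show "(\<lambda>m. H1_norm U (\<lambda>x. \<phi> m x - w x) + H1_norm U (\<lambda>x. \<psi> m x - w' x)) \<longlonglongrightarrow> 0"
      using tendsto_add [OF \<phi>_lim(1) \<psi>_lim(1)] by simp
  qed (simp add: H1_norm_nonneg)
  moreover have "(\<lambda>m. L2_norm ?M (\<lambda>x. \<phi> m x - \<psi> m x - (g x - g' x))) \<longlonglongrightarrow> 0"
  proof (rule tendsto_sandwich [OF _ _ tendsto_const])
    show "\<forall>\<^sub>F m in sequentially. L2_norm ?M (\<lambda>x. \<phi> m x - \<psi> m x - (g x - g' x)) \<le>
        L2_norm ?M (\<lambda>x. \<phi> m x - g x) + L2_norm ?M (\<lambda>x. \<psi> m x - g' x)"
      unfolding swap [of _ "\<psi> _ _"] using \<phi> \<psi> g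
      by (intro always_eventually allI L2_norm_triangle_diff L2_diff)
    show "(\<lambda>m. L2_norm ?M (\<lambda>x. \<phi> m x - g x) + L2_norm ?M (\<lambda>x. \<psi> m x - g' x)) \<longlonglongrightarrow> 0"
      using tendsto_add [OF \<phi>_lim(2) \<psi>_lim(2)] by simp
  qed (simp add: L2_norm_nonneg)
  ultimately show ?thesis
    unfolding has_trace_def using assms(1) \<phi> \<psi> w g
    by (intro conjI exI [of _ "\<lambda>m x. \<phi> m x - \<psi> m x"] allI) (auto intro: smooth_diff H1_diff L2_diff)
qed

lemma facet_trace_cong:
  "facet_trace M L w g \<Longrightarrow> (\<And>x. x \<in> L \<Longrightarrow> g x = g' x) \<Longrightarrow> facet_trace M L w g'"
  unfolding facet_trace_def by (blast intro: has_trace_cong)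

lemma facet_trace_diff:
  "facet_trace M L w g \<Longrightarrow> facet_trace M L w' g' \<Longrightarrow>
    facet_trace M L (\<lambda>x. w x - w' x) (\<lambda>x. g x - g' x)"
  unfolding facet_trace_def by (blast intro: has_trace_diff open_interior)

section \<open>The SBFEM space is closed under differences\<close>

lemma H1_uminus:
  assumes "open U" "w \<in> H1 U"
  shows "(\<lambda>x. - w x) \<in> H1 U"
  \<comment> \<open>Negation is obtained from subtraction alone, as (w - w) - w.\<close>
  using H1_diff [OF assms(1) H1_diff [OF assms assms(2)] assms(2)] by simp

text \<open>The sign is absorbed by the radial profile, which leaves the trace factor \<alpha>
  unchanged.\<close>

lemma duffy_products_uminus:
  assumes "\<phi> \<in> duffy_products M k S"
  shows "(\<lambda>x. - \<phi> x) \<in> duffy_products M k S"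
proof -
  obtain \<rho> \<alpha> where *: "continuous_on {0<..1} \<rho>" "\<alpha> \<in> trace_space k (facets M S)"
    "radial_extension M S \<rho> \<alpha> \<phi>" "\<phi> \<in> H1 (interior S)"
    using assms by (auto simp: duffy_products_def)
  have "continuous_on {0<..1} (\<lambda>t. - \<rho> t)"
    using *(1) by (rule continuous_on_minus)
  moreover have "radial_extension M S (\<lambda>t. - \<rho> t) \<alpha> (\<lambda>x. - \<phi> x)"
    using *(3) unfolding radial_extension_def by eventually_elim auto
  ultimately show ?thesis
    using * H1_uminus [OF open_interior] unfolding duffy_products_def by blast
qed

lemma duffy_space_diff:
  assumes "\<phi> \<in> duffy_space M k S" "\<psi> \<in> duffy_space M k S"
  shows "(\<lambda>x. \<phi> x - \<psi> x) \<in> duffy_space M k S"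
proof -
  obtain m :: nat and f where f: "\<forall>j<m. f j \<in> duffy_products M k S"
    and f_sum: "AE x in lebesgue_on (interior S). \<phi> x = (\<Sum>j<m. f j x)"
    using assms(1) unfolding duffy_space_def by blast
  obtain n :: nat and g where g: "\<forall>j<n. g j \<in> duffy_products M k S"
    and g_sum: "AE x in lebesgue_on (interior S). \<psi> x = (\<Sum>j<n. g j x)"
    using assms(2) unfolding duffy_space_def by blast
  \<comment> \<open>The two families are concatenated: indices below \<open>m\<close> list the
    products of \<phi>, the next \<open>n\<close> the negated products of \<psi>, shifted by
    \<open>m\<close>.\<close>
  define h where "h j = (if j < m then f j else (\<lambda>x. - g (j - m) x))" for j
  have sum_h: "(\<Sum>j<m + n. h j x) = (\<Sum>j<m. f j x) - (\<Sum>j<n. g j x)" for x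
  proof -
    have "(\<Sum>j<m + n. h j x) = (\<Sum>j<m. h j x) + (\<Sum>j<n. h (m + j) x)"
      by (induction n) simp_all
    then show ?thesis
      by (simp add: h_def sum_negf)
  qed
  have "AE x in lebesgue_on (interior S). \<phi> x - \<psi> x = (\<Sum>j<m + n. h j x)"
    using f_sum g_sum unfolding sum_h by eventually_elim simp
  moreover have "\<forall>j<m + n. h j \<in> duffy_products M k S"
    using f g by (auto simp: h_def duffy_products_uminus)
  moreover have "(\<lambda>x. \<phi> x - \<psi> x) \<in> H1 (interior S)"
    using assms by (auto simp: duffy_space_def intro: H1_diff)
  ultimately show ?thesis
    unfolding duffy_space_def by blast
qed

lemma sbfem_local_diff:
  assumes "\<phi> \<in> sbfem_local M k S" "\<psi> \<in> sbfem_local M k S"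
  shows "(\<lambda>x. \<phi> x - \<psi> x) \<in> sbfem_local M k S"
proof -
  have "\<phi> \<in> H1 (interior S)" "\<psi> \<in> H1 (interior S)"
    using assms by (auto simp: sbfem_local_def duffy_space_def)
  then have "dirichlet_form (interior S) (\<lambda>x. \<phi> x - \<psi> x) \<eta> =
      dirichlet_form (interior S) \<phi> \<eta> - dirichlet_form (interior S) \<psi> \<eta>"
    if "\<eta> \<in> duffy_const0 M S" for \<eta>
    using that by (intro dirichlet_form_diff_left) (auto simp: duffy_const0_def)
  then show ?thesis
    using assms by (auto simp: sbfem_local_def duffy_space_diff)
qed

lemma sbfem_space_diff:
  assumes "open \<Omega>" "w \<in> sbfem_space M \<Omega> k" "v \<in> sbfem_space M \<Omega> k"
  shows "(\<lambda>x. w x - v x) \<in> sbfem_space M \<Omega> k"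
  using assms by (auto simp: sbfem_space_def H1_diff sbfem_local_diff)

section \<open>The Galerkin error\<close>

text \<open>Pythagoras for u - z = (u - w) + (w - z): the cross term vanishes and the square of the
  second summand is nonnegative.\<close>

lemma H1_seminorm_le_of_orthogonal:
  assumes "open U" "u \<in> H1 U" "w \<in> H1 U" "z \<in> H1 U"
    and orth: "dirichlet_form U (\<lambda>x. u x - w x) (\<lambda>x. w x - z x) = 0"
  shows "H1_seminorm U (\<lambda>x. u x - w x) \<le> H1_seminorm U (\<lambda>x. u x - z x)"
proof -
  have "dirichlet_form U (\<lambda>x. u x - z x) (\<lambda>x. u x - z x) =
      dirichlet_form U (\<lambda>x. u x - w x) (\<lambda>x. u x - w x) +
      dirichlet_form U (\<lambda>x. w x - z x) (\<lambda>x. w x - z x) +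
      2 * dirichlet_form U (\<lambda>x. u x - w x) (\<lambda>x. w x - z x)"
    using assms(1-4)
    by (simp add: dirichlet_form_diff_left dirichlet_form_diff_right H1_diff
        dirichlet_form_commute [of U w u] dirichlet_form_commute [of U z u]
        dirichlet_form_commute [of U z w])
  then show ?thesis
    using orth dirichlet_form_nonneg [of U "\<lambda>x. w x - z x"]
    by (simp add: H1_seminorm_eq_sqrt)
qed

theorem theorem5p2:
  fixes \<Omega> :: "'a::euclidean_space set"
    and M :: "'a sb_mesh"
    and k :: nat
    and W :: "('a \<Rightarrow> real) set"
    and I F P :: "('a \<Rightarrow> real) \<Rightarrow> 'a \<Rightarrow> real"
    and J :: "'a set \<Rightarrow> ('a \<Rightarrow> real) \<Rightarrow> 'a \<Rightarrow> real"
    and u uD uh :: "'a \<Rightarrow> real"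
  assumes "DIM('a) = 2 \<or> DIM('a) = 3"
    and "conformal_partition M \<Omega>"
    and "trace_interpolant M \<Omega> k W I J"
    and "sbfem_interpolant M \<Omega> k W I P"
    and "harmonic_interpolant M \<Omega> k W I F"
    and "model_solution M \<Omega> uD u"
    and "u \<in> W"
    and "galerkin_sbfem M \<Omega> k J uD uh"
  shows "H1_seminorm \<Omega> (\<lambda>x. u x - uh x)
           \<le> H1_seminorm \<Omega> (\<lambda>x. u x - F u x) + H1_seminorm \<Omega> (\<lambda>x. F u x - P (F u) x)"
proof -
  have "open \<Omega>"
    using assms(2) by (simp add: conformal_partition_def)
  \<comment> \<open>\<open>facet_trace\<close> tests only elements having \<open>L\<close> as a
    facet, so the elementwise traces give \<open>P_trace\<close> for arbitrary
    \<open>L\<close>.\<close>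
  have P_sbfem: "P w \<in> sbfem_space M \<Omega> k"
    and P_duffy: "\<forall>S\<in>elements M. P w \<in> duffy_space M k S"
    and P_trace: "\<And>L. facet_trace M L (P w) (I w)" if "w \<in> W" for w
    using assms(4) that by (auto simp: sbfem_interpolant_def facet_trace_def)
  have F_H1: "F u \<in> H1 \<Omega>" and F_trace: "\<And>L. facet_trace M L (F u) (I u)"
    using assms(5,7)
    by (auto simp: harmonic_interpolant_def harmonic_virtual_space_def facet_trace_def)
  have I_eq: "I w x = J L g x" if "w \<in> W" "L \<in> all_facets M" "facet_trace M L w g" "x \<in> L" for w L g x
    using assms(3) that by (auto simp: trace_interpolant_def)
  have Pu_H1: "P u \<in> H1 \<Omega>"
    using P_sbfem [OF assms(7)] by (simp add: sbfem_space_def)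
  \<comment> \<open>\<open>P u\<close> lies elementwise in the Duffy space, where the trace
    interpolant reproduces traces.\<close>
  have Pu_W: "P u \<in> W"
    and Pu_trace: "\<And>L. L \<in> all_facets M \<Longrightarrow> facet_trace M L (P u) (I (P u))"
    using assms(3) Pu_H1 P_duffy [OF assms(7)] by (auto simp: trace_interpolant_def)
  \<comment> \<open>Membership in \<open>W\<close> passes between functions with common facet
    traces. It is taken over from \<open>P u\<close>, which shares the trace \<open>I u\<close> with
    \<open>F u\<close>; the trace of \<open>u\<close> itself is in general a different one.\<close>
  have Fu_W: "F u \<in> W"
  proof -
    have "\<forall>w\<in>W. \<forall>w'\<in>H1 \<Omega>.
        (\<forall>L\<in>all_facets M. \<exists>g. facet_trace M L w g \<and> facet_trace M L w' g) \<longrightarrow> w' \<in> W"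
      using assms(3) by (simp add: trace_interpolant_def)
    then show ?thesis
      using Pu_W F_H1 P_trace [OF assms(7)] F_trace by blast
  qed
  let ?z = "P (F u)"
  have u: "u \<in> H1 \<Omega>" "\<And>v. v \<in> H10 M \<Omega> \<Longrightarrow> dirichlet_form \<Omega> u v = 0"
    and u_trace: "\<And>L. L \<in> boundary_facets M \<Omega> \<Longrightarrow> facet_trace M L u uD"
    using assms(6) by (auto simp: model_solution_def)
  have uh: "uh \<in> sbfem_space M \<Omega> k"
    "\<And>v. v \<in> sbfem_space M \<Omega> k \<Longrightarrow> v \<in> H10 M \<Omega> \<Longrightarrow> dirichlet_form \<Omega> uh v = 0"
    and uh_trace: "\<And>L. L \<in> boundary_facets M \<Omega> \<Longrightarrow> facet_trace M L uh (J L uD)"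
    using assms(8) by (auto simp: galerkin_sbfem_def)
  have z: "?z \<in> sbfem_space M \<Omega> k"
    using P_sbfem Fu_W by blast
  have H1: "uh \<in> H1 \<Omega>" "?z \<in> H1 \<Omega>"
    using uh(1) z by (auto simp: sbfem_space_def)
  have v: "(\<lambda>x. uh x - ?z x) \<in> sbfem_space M \<Omega> k"
    using \<open>open \<Omega>\<close> uh(1) z by (rule sbfem_space_diff)
  text \<open>
    Uniqueness of traces is avoided: \<open>uh\<close> and \<open>P u\<close> share the trace \<open>I u\<close>, while \<open>P u\<close> and \<open>P (F u)\<close>
    share the trace \<open>I (P u)\<close>.
  \<close>
  have "facet_trace M L (\<lambda>x. uh x - ?z x) (\<lambda>_. 0)" if L: "L \<in> boundary_facets M \<Omega>" for L
  proof -
    have L': "L \<in> all_facets M"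
      using L by (simp add: boundary_facets_def)
    \<comment> \<open>On a boundary facet \<open>u\<close> has trace \<open>uD\<close>, so
      \<open>I u\<close> agrees there with the discrete data \<open>J L uD\<close>.\<close>
    have "facet_trace M L uh (I u)"
      by (rule facet_trace_cong [OF uh_trace [OF L]])
        (simp add: I_eq [OF assms(7) L' u_trace [OF L]])
    then have 1: "facet_trace M L (\<lambda>x. uh x - P u x) (\<lambda>_. 0)"
      using facet_trace_diff [OF _ P_trace [OF assms(7)]] by fastforce
    \<comment> \<open>Both \<open>P u\<close> and \<open>F u\<close> have trace \<open>I u\<close>
      on \<open>L\<close>, so both interpolants equal \<open>J L (I u)\<close> there.\<close>
    have "facet_trace M L (P u) (I (F u))"
      using Pu_trace [OF L']
    proof (rule facet_trace_cong)
      fix x assume "x \<in> L"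
      then show "I (P u) x = I (F u) x"
        using I_eq [OF Pu_W L' P_trace [OF assms(7)]] I_eq [OF Fu_W L' F_trace] by simp
    qed
    then have 2: "facet_trace M L (\<lambda>x. ?z x - P u x) (\<lambda>_. 0)"
      using facet_trace_diff [OF P_trace [OF Fu_W]] by fastforce
    show ?thesis
      using facet_trace_diff [OF 1 2] by simp
  qed
  then have v0: "(\<lambda>x. uh x - ?z x) \<in> H10 M \<Omega>"
    using \<open>open \<Omega>\<close> H1 by (simp add: H10_def H1_diff)
  \<comment> \<open>Galerkin orthogonality: the test function lies in \<open>H10\<close>, as the
    equation for \<open>u\<close> demands, and also in the SBFEM space, as the one for
    \<open>uh\<close> demands.\<close>
  have "dirichlet_form \<Omega> (\<lambda>x. u x - uh x) (\<lambda>x. uh x - ?z x) = 0"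
    using \<open>open \<Omega>\<close> u H1 v v0 uh(2) by (simp add: dirichlet_form_diff_left H1_diff)
  then have "H1_seminorm \<Omega> (\<lambda>x. u x - uh x) \<le> H1_seminorm \<Omega> (\<lambda>x. u x - ?z x)"
    using \<open>open \<Omega>\<close> u(1) H1 by (intro H1_seminorm_le_of_orthogonal)
  also have "\<dots> = H1_seminorm \<Omega> (\<lambda>x. (u x - F u x) - (?z x - F u x))"
    by simp
  also have "\<dots> \<le> H1_seminorm \<Omega> (\<lambda>x. u x - F u x) + H1_seminorm \<Omega> (\<lambda>x. ?z x - F u x)"
    using \<open>open \<Omega>\<close> u(1) F_H1 H1 by (intro H1_seminorm_triangle_diff H1_diff)
  also have "H1_seminorm \<Omega> (\<lambda>x. ?z x - F u x) = H1_seminorm \<Omega> (\<lambda>x. F u x - ?z x)"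
    using \<open>open \<Omega>\<close> H1(2) F_H1 by (rule H1_seminorm_minus_commute)
  finally show ?thesis .
qed

end
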